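(* Let $p_n(x,t)=\sum_{k=0}^{\infty} b_{n,k}(x)h_{n,k}(t)$, $x\in X$, be a statistical structure of Phillips type, built from a structure $\mathbf B$ with covariance characteristic $b(x)$ and a structure $\mathbf H$ with covariance characteristic $h(t)$, and let $\eta$ be a random variable with density $p_n(x,t)$. Let the covariance characteristic $h$ of the structure $\mathbf H$ be a polynomial of degree $r$. Then for the central moments $\mu_m(x)$ of the random variable $\eta$ the following recurrence relation holds: $$b(x)\bigl(\mu_m'(x)+m\,\alpha'(x)\mu_{m-1}(x)\bigr)=n\mu_{m+1}(x)+n(\alpha(x)-x)\mu_m(x)-\sum_{i=0}^{r}\frac{m+i}{i!}\,h^{(i)}(\alpha(x))\,\mu_{m+i-1}(x),$$ where $\alpha(x)$ is the mathematical expectation of $\eta$.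
   Context: Structure $\mathbf B$: an integer-valued statistical structure $b_{n,k}(x)$, $k=0,1,2,\dots$, depending on parameters $x\in X$, $n\in\mathbb N$ (for each $n$ and $x$ the numbers $b_{n,k}(x)$, $k=0,1,2,\dots$, are the probabilities of a distribution on the nonnegative integers), such that $$b(x)\frac{d}{dx}b_{n,k}(x)=(k-nx)\,b_{n,k}(x),$$ where $b(x)$ is a non-negative function called the covariance characteristic of the structure. Such a structure is constructed from a power series $\omega(y)=\sum_{k=0}^\infty a_ky^k$ with $a_k\ge 0$, $0\le y<R$, where $R$ is its radius of convergence: $b_{n,k}(x)=b_k\,(y(x))^k/(\omega(y(x)))^n$, where $b_k$ are the power series coefficients of $(\omega(y))^n$, $y(x)$ is the inverse function of $x(y)=y\,\omega'(y)/\omega(y)$, and $b(x)=y(x)/y'(x)$. Structure $\mathbf H$: a family of probability densities $h_{n,k}(t)$, $k=0,1,2,\dots$, $n\in\mathbb N$, such that $$h(t)\frac{d}{dt}h_{n,k}(t)=(k-nt)\,h_{n,k}(t),$$ where $h(t)$ is a non-negative function called the covariance characteristic of the structure. If the argument $t$ of the density is specified on an interval different from the entire number line, the density is taken to be zero outside this interval. Statistical structure of Phillips type: the family of densities $p_n(x,t)=\sum_{k=0}^{\infty} b_{n,k}(x)h_{n,k}(t)$ depending on the parameter $x\in X$, where $X$ is the image of the interval $[0,R)$ under the mapping $x=x(y)$. Expectation and central moments of $\eta$: $\alpha(x)=\sum_{k=0}^{\infty} b_{n,k}(x)\int_{-\infty}^{\infty}t\,h_{n,k}(t)\,dt$ and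 $\mu_m(x)=\sum_{k=0}^{\infty} b_{n,k}(x)\int_{-\infty}^{\infty}(t-\alpha(x))^m h_{n,k}(t)\,dt$. $h^{(i)}$ denotes the $i$-th derivative of $h$.
   Formalization: Added: h(t)h_{n,k}(t) is continuous on the whole line (no boundary terms at finite endpoints; normal densities cut to [0,1] with h=1 violate the formula); also a_0>0, ω nonconstant with R>0, and η has finite moments up to order max(m+1,m+r-1). *)

theory Defs
  imports "HOL-Analysis.Analysis"
begin

text \<open>
  The generating series \<open>\<omega>(y) = \<Sum>k. a\<^sub>k y\<^sup>k\<close> is a formal power series \<open>W\<close>.
  Positivity of \<open>a\<^sub>0\<close> is what makes \<open>x(y) = y \<omega>'(y) / \<omega>(y)\<close> meaningful on all of
  \<open>[0, R)\<close>; a further nonzero coefficient makes that map injective.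
\<close>

definition structure_B :: "real fps \<Rightarrow> bool" where
  "structure_B W \<longleftrightarrow>
     (\<forall>k. 0 \<le> fps_nth W k) \<and> 0 < fps_nth W 0 \<and> (\<exists>k\<ge>1. 0 < fps_nth W k) \<and>
     0 < fps_conv_radius W"

definition B_dom :: "real fps \<Rightarrow> real set" where
  "B_dom W = {y. 0 \<le> y \<and> ereal y < fps_conv_radius W}"

definition B_x :: "real fps \<Rightarrow> real \<Rightarrow> real" where
  "B_x W y = y * deriv (eval_fps W) y / eval_fps W y"

definition B_X :: "real fps \<Rightarrow> real set" where
  "B_X W = B_x W ` B_dom W"

definition B_y :: "real fps \<Rightarrow> real \<Rightarrow> real" where
  "B_y W = the_inv_into (B_dom W) (B_x W)"

text \<open>
  \<open>B_X W\<close> has the form \<open>[0, s)\<close>, so the derivative is one-sided at \<open>0\<close>.  If \<open>a\<^sub>1 = 0\<close>,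
  the function \<open>y\<close> has infinite slope there; as \<open>y(0) = 0\<close>, the quotient is \<open>0\<close> at \<open>x = 0\<close>
  in every case, which is also its limit.
\<close>

definition B_cov :: "real fps \<Rightarrow> real \<Rightarrow> real" where
  "B_cov W x = B_y W x / vector_derivative (B_y W) (at x within B_X W)"

definition B_prob :: "real fps \<Rightarrow> nat \<Rightarrow> nat \<Rightarrow> real \<Rightarrow> real" where
  "B_prob W n k x = fps_nth (W ^ n) k * B_y W x ^ k / eval_fps W (B_y W x) ^ n"

text \<open>
  The densities live on an interval \<open>I\<close> and are extended by zero.  Such an extension may jump at
  an endpoint of \<open>I\<close> (\<open>n exp (- n t)\<close> on \<open>t \<ge> 0\<close>, with \<open>h t = t\<close>, \<open>k = 0\<close>), so the
  differential equation is imposed classically inside \<open>I\<close> only.  Continuity of \<open>h\<close> times the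
  density says that the equation also holds across the endpoints in the weak sense, that is,
  integration by parts leaves no boundary terms at finite endpoints.  For polynomial \<open>h\<close> it is automatic if
  \<open>I = UNIV\<close>, and also if \<open>h\<close> vanishes at the finite endpoints of \<open>I\<close>; it
  excludes, for instance, truncated normal densities with \<open>h = 1\<close>.
\<close>

definition structure_H ::
  "(real \<Rightarrow> real) \<Rightarrow> real set \<Rightarrow> (nat \<Rightarrow> nat \<Rightarrow> real \<Rightarrow> real) \<Rightarrow> nat \<Rightarrow> bool" where
  "structure_H h I den n \<longleftrightarrow>
     is_interval I \<and> (\<forall>t\<in>I. 0 \<le> h t) \<and>
     (\<forall>k. (\<forall>t. 0 \<le> den n k t) \<and>
          has_bochner_integral lborel (den n k) 1 \<and>
          (\<forall>t. t \<notin> I \<longrightarrow> den n k t = 0) \<and>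
          (\<forall>t\<in>interior I. den n k differentiable (at t) \<and>
             h t * deriv (den n k) t = (real k - real n * t) * den n k t) \<and>
          continuous_on UNIV (\<lambda>t. h t * den n k t))"

definition phillips_density ::
  "real fps \<Rightarrow> (nat \<Rightarrow> nat \<Rightarrow> real \<Rightarrow> real) \<Rightarrow> nat \<Rightarrow> real \<Rightarrow> real \<Rightarrow> real" where
  "phillips_density W den n x t = (\<Sum>k. B_prob W n k x * den n k t)"

definition phillips_mean ::
  "real fps \<Rightarrow> (nat \<Rightarrow> nat \<Rightarrow> real \<Rightarrow> real) \<Rightarrow> nat \<Rightarrow> real \<Rightarrow> real" where
  "phillips_mean W den n x =
     (\<Sum>k. B_prob W n k x * (\<integral>t. t * den n k t \<partial>lborel))"

definition phillips_central_moment ::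
  "real fps \<Rightarrow> (nat \<Rightarrow> nat \<Rightarrow> real \<Rightarrow> real) \<Rightarrow> nat \<Rightarrow> nat \<Rightarrow> real \<Rightarrow> real" where
  "phillips_central_moment W den n m x =
     (\<Sum>k. B_prob W n k x * (\<integral>t. (t - phillips_mean W den n x) ^ m * den n k t \<partial>lborel))"

end

theory Submission
  imports Defs
begin

text \<open>
  If \<open>P(y) = \<Sum>k. b\<^sub>k c\<^sub>k y\<^sup>k\<close>, where the \<open>b\<^sub>k\<close> are the coefficients of \<open>\<omega>\<^sup>n\<close>, then
  \<open>f(x) = P(y(x)) / \<omega>(y(x))\<^sup>n\<close> satisfies \<open>b(x) f'(x) = \<Sum>k. (k - n x) b\<^sub>n\<^sub>,\<^sub>k(x) c\<^sub>k\<close>.  For a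
  polynomial \<open>p\<close> take \<open>c\<^sub>k = \<integral> p h\<^sub>n\<^sub>,\<^sub>k\<close>.  Integrating \<open>(p h h\<^sub>n\<^sub>,\<^sub>k)'\<close> and using the differential
  equation for \<open>h\<^sub>n\<^sub>,\<^sub>k\<close> gives \<open>k c\<^sub>k = n \<integral> t p h\<^sub>n\<^sub>,\<^sub>k - \<integral> (p h)' h\<^sub>n\<^sub>,\<^sub>k\<close>.  There is no boundary term at infinity:
  \<open>F = p h h\<^sub>n\<^sub>,\<^sub>k\<close> has a limit because \<open>F'\<close> is integrable, and \<open>F(t) / (1 + \<bar>t\<bar>)\<close> is
  integrable while \<open>1 / (1 + \<bar>t\<bar>)\<close> is not, so the limit is \<open>0\<close>.  The recurrence is the
  case \<open>p = (t - \<alpha>(x))\<^sup>m\<close>, with \<open>h\<close> expanded in powers of \<open>t - \<alpha>(x)\<close>.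
\<close>

subsection \<open>Integration by parts against a density\<close>

text \<open>If L were nonzero, |F| would exceed |L| / 2 from some point on, and the integral of |F|
  / (1 + t) would grow at least logarithmically.\<close>

lemma tendsto_at_top_integrable_quotient:
  fixes F :: "real \<Rightarrow> real"
  assumes lim: "(F \<longlongrightarrow> L) at_top" and int: "integrable lborel (\<lambda>t. F t / (1 + \<bar>t\<bar>))"
  shows "L = 0"
proof (rule ccontr)
  assume "L \<noteq> 0"
  define c where "c = \<bar>L\<bar> / 2"
  have c: "0 < c" using \<open>L \<noteq> 0\<close> by (simp add: c_def)
  have "eventually (\<lambda>t. c < \<bar>F t\<bar>) at_top"
    using \<open>L \<noteq> 0\<close> by (intro order_tendstoD(1)[OF tendsto_rabs[OF lim]]) (simp add: c_def)
  then obtain T0 where T0: "\<And>t. T0 \<le> t \<Longrightarrow> c < \<bar>F t\<bar>"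
    by (auto simp: eventually_at_top_linorder)
  define T where "T = max 0 T0"
  have T: "0 \<le> T" "\<And>t. T \<le> t \<Longrightarrow> c < \<bar>F t\<bar>"
    using T0 by (auto simp: T_def)
  define K where "K = (\<integral>t. \<bar>F t / (1 + \<bar>t\<bar>)\<bar> \<partial>lborel)"
  \<comment> \<open>Chosen so that c * (ln (1 + X) - ln (1 + T)) = K + c: the integral over [T, X]
    overshoots the total K.\<close>
  define X where "X = (1 + T) * exp (K / c + 1) - 1"
  have "0 \<le> K"
    by (simp add: K_def)
  then have "1 \<le> exp (K / c + 1)"
    using c by (subst one_le_exp_iff) simp
  then have "(1 + T) * 1 \<le> (1 + T) * exp (K / c + 1)"
    using T(1) by (intro mult_left_mono) auto
  then have "T \<le> X"
    by (simp add: X_def)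
  have "has_bochner_integral lborel (\<lambda>t. c / (1 + t) * indicator {T..X} t)
      (c * ln (1 + X) - c * ln (1 + T))"
    using T(1) \<open>T \<le> X\<close>
    by (intro has_bochner_integral_FTC_Icc_real)
       (auto intro!: derivative_eq_intros continuous_intros)
  then have "c * ln (1 + X) - c * ln (1 + T) = (\<integral>t. c / (1 + t) * indicator {T..X} t \<partial>lborel)"
    and ci: "integrable lborel (\<lambda>t. c / (1 + t) * indicator {T..X} t)"
    by (auto simp: has_bochner_integral_iff)
  note this(1)
  also have "(\<integral>t. c / (1 + t) * indicator {T..X} t \<partial>lborel) \<le> K"
    unfolding K_def
  proof (rule integral_mono[OF ci])
    show "integrable lborel (\<lambda>t. \<bar>F t / (1 + \<bar>t\<bar>)\<bar>)"
      using int by (rule integrable_abs)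
    show "c / (1 + t) * indicator {T..X} t \<le> \<bar>F t / (1 + \<bar>t\<bar>)\<bar>" for t
      using T(1) less_imp_le[OF T(2)[of t]] by (auto simp: indicator_def intro!: divide_right_mono)
  qed
  finally have "c * (ln (1 + X) - ln (1 + T)) \<le> K"
    by (simp add: algebra_simps)
  moreover have "ln (1 + X) = ln (1 + T) + (K / c + 1)"
    using T(1) by (simp add: X_def ln_mult)
  ultimately show False
    using c by (simp add: algebra_simps)
qed

text \<open>By the fundamental theorem on [0, X] and integrability of f, F X converges as X grows;
  the preceding lemma forces the limit to be 0. \<open>S\<close> will hold the endpoints of the
  support interval, where F is continuous but perhaps not differentiable.\<close>

lemma integral_derivative_half_line:
  fixes F f :: "real \<Rightarrow> real"
  assumes S: "finite S" and cont: "continuous_on UNIV F"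
    and deriv: "\<And>t. t \<notin> S \<Longrightarrow> (F has_real_derivative f t) (at t)"
    and f: "integrable lborel f" and F: "integrable lborel (\<lambda>t. F t / (1 + \<bar>t\<bar>))"
  shows "(\<integral>t. indicator {0..} t * f t \<partial>lborel) = - F 0"
proof -
  let ?J = "\<integral>t. indicator {0..} t * f t \<partial>lborel"
  have int: "integrable lborel (\<lambda>t. indicator A t * f t)" if "A \<in> sets borel" for A
    using integrable_mult_indicator[of A lborel f] f that by simp
  have "((\<lambda>X. \<integral>t. indicator {..X} t *\<^sub>R (indicator {0..} t * f t) \<partial>lborel) \<longlongrightarrow> ?J) at_top"
    using int by (intro tendsto_integral_at_top) auto
  moreover have "eventually (\<lambda>X. (\<integral>t. indicator {..X} t *\<^sub>R (indicator {0..} t * f t) \<partial>lborel)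
      = F X - F 0) at_top"
    using eventually_ge_at_top[of 0]
  proof eventually_elim
    case (elim X)
    have "(f has_integral F X - F 0) {0..X}"
      using deriv continuous_on_subset[OF cont] elim
      by (intro fundamental_theorem_of_calculus_interior_strong[OF S])
         (auto simp: has_real_derivative_iff_has_vector_derivative)
    moreover have "set_integrable lborel {0..X} f"
      using int[of "{0..X}"] by (simp add: set_integrable_def)
    ultimately have "(LINT t:{0..X}|lborel. f t) = F X - F 0"
      by (simp add: set_borel_integral_eq_integral(2) integral_unique)
    moreover have "(\<lambda>t. indicator {..X} t *\<^sub>R (indicator {0..} t * f t))
        = (\<lambda>t. indicator {0..X} t *\<^sub>R f t)"
      by (auto simp: fun_eq_iff indicator_def)
    ultimately show ?case
      by (simp only: set_lebesgue_integral_def)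
  qed
  ultimately have "((\<lambda>X. F X - F 0) \<longlongrightarrow> ?J) at_top"
    by (rule Lim_transform_eventually)
  then have "((\<lambda>X. F X - F 0 + F 0) \<longlongrightarrow> ?J + F 0) at_top"
    by (intro tendsto_intros)
  then have "?J + F 0 = 0"
    using F by (intro tendsto_at_top_integrable_quotient) auto
  then show ?thesis by simp
qed

text \<open>The two half-lines contribute F 0 with opposite signs; the left one is the right one for
  the reflected function \<open>F (- t)\<close>.\<close>

lemma integral_derivative_eq_0:
  fixes F f :: "real \<Rightarrow> real"
  assumes S: "finite S" and cont: "continuous_on UNIV F"
    and deriv: "\<And>t. t \<notin> S \<Longrightarrow> (F has_real_derivative f t) (at t)"
    and f: "integrable lborel f" and F: "integrable lborel (\<lambda>t. F t / (1 + \<bar>t\<bar>))"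
  shows "(\<integral>t. f t \<partial>lborel) = 0"
proof -
  have int: "integrable lborel (\<lambda>t. indicator A t * f t)" if "A \<in> sets borel" for A
    using integrable_mult_indicator[of A lborel f] f that by simp
  have right: "(\<integral>t. indicator {0..} t * f t \<partial>lborel) = - F 0"
    by (rule integral_derivative_half_line[OF assms])
  have "(\<integral>t. indicator {0..} t * - f (- t) \<partial>lborel) = - F (- 0)"
  proof (rule integral_derivative_half_line[where F = "\<lambda>t. F (- t)" and S = "uminus ` S"])
    show "continuous_on UNIV (\<lambda>t. F (- t))"
      using cont by (rule continuous_on_compose2) (auto intro: continuous_intros)
    show "((\<lambda>t. F (- t)) has_real_derivative - f (- t)) (at t)" if "t \<notin> uminus ` S" for t
    proof -
      have "- t \<notin> S" using that by (metis image_eqI minus_minus)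
      then show ?thesis
        using DERIV_chain2[OF deriv DERIV_minus[OF DERIV_ident], of t] by simp
    qed
    show "integrable lborel (\<lambda>t. - f (- t))"
      using lborel_integrable_real_affine[OF f, of "- 1" 0] by simp
    show "integrable lborel (\<lambda>t. F (- t) / (1 + \<bar>t\<bar>))"
      using lborel_integrable_real_affine[OF F, of "- 1" 0] by simp
  qed (use S in simp)
  also have "(\<integral>t. indicator {0..} t * - f (- t) \<partial>lborel) = - (\<integral>t. indicator {..0} (- t) * f (- t) \<partial>lborel)"
    by (subst Bochner_Integration.integral_minus[symmetric])
       (auto intro!: Bochner_Integration.integral_cong simp: indicator_def)
  also have "(\<integral>t. indicator {..0} (- t) * f (- t) \<partial>lborel) = (\<integral>t. indicator {..0} t * f t \<partial>lborel)"
    using lborel_integral_real_affine[of "- 1" "\<lambda>t. indicator {..0} t * f t" 0] by simp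
  finally have left: "(\<integral>t. indicator {..0} t * f t \<partial>lborel) = F 0"
    by simp
  \<comment> \<open>The two closed half-lines overlap only in the null set {0}.\<close>
  have "(\<integral>t. f t \<partial>lborel) = (\<integral>t. indicator {0..} t * f t + indicator {..0} t * f t \<partial>lborel)"
  proof (rule integral_cong_AE)
    show "AE t in lborel. f t = indicator {0..} t * f t + indicator {..0} t * f t"
      using AE_lborel_singleton[of 0] by eventually_elim (auto simp: indicator_def)
  qed (use f in auto)
  also have "\<dots> = 0"
    using int by (subst Bochner_Integration.integral_add) (auto simp: left right)
  finally show ?thesis .
qed

text \<open>A frontier point strictly between two others lies between points of I approximating
  these two, hence is interior. So there are at most two frontier points.\<close>

lemma finite_frontier_interval:
  fixes I :: "real set"
  assumes I: "is_interval I"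
  shows "finite (frontier I)"
proof (rule ccontr)
  assume "infinite (frontier I)"
  then obtain T where "T \<subseteq> frontier I" "card T = 3"
    using infinite_arbitrarily_large by blast
  then obtain u v w where uvw: "{u, v, w} \<subseteq> frontier I" "u \<noteq> v" "v \<noteq> w" "u \<noteq> w"
    by (auto simp: card_3_iff)
  have no_middle: False if xyz: "x \<in> frontier I" "y \<in> frontier I" "z \<in> frontier I" "x < y" "y < z" for x y z
  proof -
    have "x \<in> closure I" "z \<in> closure I"
      using xyz by (auto simp: frontier_def)
    then obtain a b where ab: "a \<in> I" "dist a x < y - x" "b \<in> I" "dist b z < z - y"
      using xyz unfolding closure_approachable by (metis diff_gt_0_iff_gt)
    have "{a<..<b} \<subseteq> I"
      using mem_is_interval_1_I[OF I ab(1,3)] by auto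
    moreover have "y \<in> {a<..<b}"
      using ab by (auto simp: dist_real_def)
    ultimately have "y \<in> interior I"
      by (meson interiorI open_greaterThanLessThan)
    then show False
      using xyz by (simp add: frontier_def)
  qed
  consider "u < v" "v < w" | "u < w" "w < v" | "v < u" "u < w" | "v < w" "w < u" | "w < u" "u < v" | "w < v" "v < u"
    using uvw by linarith
  then show False
    using no_middle uvw(1) by cases auto
qed

text \<open>Tonelli for nonnegative terms: a finite weighted moment of a mixture passes to its
  components.\<close>

lemma summable_weighted_integrals:
  fixes g :: "nat \<Rightarrow> 'a \<Rightarrow> real" and w :: "'a \<Rightarrow> real"
  assumes nonneg: "\<And>k t. 0 \<le> g k t" and g: "\<And>k. integrable M (g k)"
    and sum: "summable (\<lambda>k. \<integral>t. g k t \<partial>M)"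
    and w[measurable]: "w \<in> borel_measurable M"
    and int: "integrable M (\<lambda>t. w t * (\<Sum>k. g k t))"
  shows "integrable M (\<lambda>t. \<bar>w t\<bar> * g k t)" "summable (\<lambda>k. \<integral>t. \<bar>w t\<bar> * g k t \<partial>M)"
proof -
  have [measurable]: "g k \<in> borel_measurable M" for k
    using g by auto
  have "(\<integral>\<^sup>+t. (\<Sum>k. ennreal (g k t)) \<partial>M) = (\<Sum>k. \<integral>\<^sup>+t. ennreal (g k t) \<partial>M)"
    by (rule nn_integral_suminf) simp
  also have "\<dots> = (\<Sum>k. ennreal (\<integral>t. g k t \<partial>M))"
    using g nonneg by (simp add: nn_integral_eq_integral)
  also have "\<dots> \<noteq> \<infinity>"
    using sum nonneg by (simp add: ennreal_suminf_neq_top)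
  \<comment> \<open>Where the series diverges, the real-valued \<open>suminf\<close> is only a
    default value; it may be identified with the sum in \<open>ennreal\<close> once summability
    holds almost everywhere.\<close>
  finally have "AE t in M. (\<Sum>k. ennreal (g k t)) \<noteq> \<infinity>"
    by (intro nn_integral_PInf_AE) auto
  then have summable: "AE t in M. summable (\<lambda>k. g k t)"
    by eventually_elim (auto intro: summable_suminf_not_top nonneg)
  have "(\<Sum>k. \<integral>\<^sup>+t. ennreal (\<bar>w t\<bar> * g k t) \<partial>M) = (\<integral>\<^sup>+t. (\<Sum>k. ennreal (\<bar>w t\<bar> * g k t)) \<partial>M)"
    by (rule nn_integral_suminf[symmetric]) simp
  also have "\<dots> = (\<integral>\<^sup>+t. ennreal (norm (w t * (\<Sum>k. g k t))) \<partial>M)"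
  proof (rule nn_integral_cong_AE)
    show "AE t in M. (\<Sum>k. ennreal (\<bar>w t\<bar> * g k t)) = ennreal (norm (w t * (\<Sum>k. g k t)))"
      using summable
    proof eventually_elim
      case (elim t)
      have "(\<Sum>k. ennreal (\<bar>w t\<bar> * g k t)) = ennreal (\<Sum>k. \<bar>w t\<bar> * g k t)"
        using elim nonneg by (intro suminf_ennreal2 summable_mult) auto
      then show ?case
        using elim nonneg by (simp add: suminf_mult abs_mult suminf_nonneg)
    qed
  qed
  also have "\<dots> < \<infinity>"
    using int by (simp add: integrable_iff_bounded)
  finally have fin: "(\<Sum>k. \<integral>\<^sup>+t. ennreal (\<bar>w t\<bar> * g k t) \<partial>M) < \<infinity>" .
  have "(\<integral>\<^sup>+t. ennreal (\<bar>w t\<bar> * g k t) \<partial>M) < \<infinity>" for k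
    using ennreal_suminf_lessD[OF fin] by simp
  then show i: "integrable M (\<lambda>t. \<bar>w t\<bar> * g k t)" for k
    using nonneg by (simp add: integrable_iff_bounded abs_mult)
  show "summable (\<lambda>k. \<integral>t. \<bar>w t\<bar> * g k t \<partial>M)"
    using fin nonneg by (intro summable_suminf_not_top)
       (auto simp: nn_integral_eq_integral[OF i])
qed

section \<open>Polynomial moments of a single density\<close>

lemma abs_poly_le:
  fixes p :: "real poly"
  assumes "degree p \<le> N"
  shows "\<bar>poly p t\<bar> \<le> (\<Sum>i\<le>degree p. \<bar>coeff p i\<bar>) * (1 + \<bar>t\<bar> ^ N)"
proof -
  have "\<bar>t\<bar> ^ i \<le> 1 + \<bar>t\<bar> ^ N" if "i \<le> N" for i
  proof (cases "\<bar>t\<bar> \<le> 1")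
    case True
    then have "\<bar>t\<bar> ^ i \<le> 1" by (simp add: power_le_one)
    then show ?thesis by (simp add: add_increasing2)
  next
    case False
    then have "\<bar>t\<bar> ^ i \<le> \<bar>t\<bar> ^ N" using that by (intro power_increasing) auto
    then show ?thesis by simp
  qed
  then have "\<bar>coeff p i * t ^ i\<bar> \<le> \<bar>coeff p i\<bar> * (1 + \<bar>t\<bar> ^ N)" if "i \<le> degree p" for i
    using that assms by (auto simp: abs_mult power_abs intro!: mult_left_mono)
  then have "(\<Sum>i\<le>degree p. \<bar>coeff p i * t ^ i\<bar>) \<le> (\<Sum>i\<le>degree p. \<bar>coeff p i\<bar> * (1 + \<bar>t\<bar> ^ N))"
    by (intro sum_mono) auto
  then show ?thesis
    unfolding poly_altdef sum_distrib_right[symmetric] by (rule order_trans[OF sum_abs])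
qed

lemma borel_measurable_poly [measurable]: "poly (p :: real poly) \<in> borel_measurable borel"
  by (intro borel_measurable_continuous_onI continuous_at_imp_continuous_on ballI poly_isCont)

text \<open>The estimate depends on f only through C, so the constant is the same for all densities
  h_{n,k}; this is what later dominates a series over k.\<close>

lemma integrable_moment_bound:
  fixes f g :: "real \<Rightarrow> real"
  assumes nonneg: "\<And>t. 0 \<le> g t" and g: "integrable lborel g"
    and moment: "integrable lborel (\<lambda>t. \<bar>t\<bar> ^ N * g t)"
    and f: "f \<in> borel_measurable borel" and bound: "\<And>t. \<bar>f t\<bar> \<le> C * (1 + \<bar>t\<bar> ^ N)"
  shows "integrable lborel (\<lambda>t. f t * g t)"
    and "\<bar>\<integral>t. f t * g t \<partial>lborel\<bar> \<le> C * ((\<integral>t. g t \<partial>lborel) + (\<integral>t. \<bar>t\<bar> ^ N * g t \<partial>lborel))"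
proof -
  have le: "\<bar>f t * g t\<bar> \<le> C * (g t + \<bar>t\<bar> ^ N * g t)" for t
    using mult_right_mono[OF bound nonneg, of t t] nonneg[of t]
    by (simp add: abs_mult algebra_simps)
  have i: "integrable lborel (\<lambda>t. C * (g t + \<bar>t\<bar> ^ N * g t))"
    using g moment by simp
  show fg: "integrable lborel (\<lambda>t. f t * g t)"
  proof (rule Bochner_Integration.integrable_bound[OF i])
    show "AE t in lborel. norm (f t * g t) \<le> norm (C * (g t + \<bar>t\<bar> ^ N * g t))"
      using le by (intro AE_I2) (simp add: order_trans[OF _ abs_ge_self])
  qed (use f g in measurable)
  have "\<bar>\<integral>t. f t * g t \<partial>lborel\<bar> \<le> (\<integral>t. \<bar>f t * g t\<bar> \<partial>lborel)"
    by (rule integral_abs_bound)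
  also have "\<dots> \<le> (\<integral>t. C * (g t + \<bar>t\<bar> ^ N * g t) \<partial>lborel)"
    using fg i le by (intro integral_mono integrable_abs) auto
  also have "\<dots> = C * ((\<integral>t. g t \<partial>lborel) + (\<integral>t. \<bar>t\<bar> ^ N * g t \<partial>lborel))"
    using g moment by simp
  finally show "\<bar>\<integral>t. f t * g t \<partial>lborel\<bar> \<le> C * ((\<integral>t. g t \<partial>lborel) + (\<integral>t. \<bar>t\<bar> ^ N * g t \<partial>lborel))" .
qed

text \<open>The derivative of p q h_{n,k} integrates to 0, and the differential equation replaces q
  h_{n,k}' by (k - n t) h_{n,k}. Under the degree bounds the N-th moment dominates t p, (p q)' and p
  q / (1 + |t|).\<close>

lemma integral_poly_density_by_parts:
  fixes p q :: "real poly"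
  assumes H: "structure_H (poly q) I den n"
    and moment: "integrable lborel (\<lambda>t. \<bar>t\<bar> ^ N * den n k t)"
    and N: "degree p + 1 \<le> N" "degree p + degree q \<le> N + 1"
  shows "real k * (\<integral>t. poly p t * den n k t \<partial>lborel)
    = real n * (\<integral>t. poly (pCons 0 p) t * den n k t \<partial>lborel)
      - (\<integral>t. poly (pderiv (p * q)) t * den n k t \<partial>lborel)"
proof -
  let ?d = "den n k"
  have I: "is_interval I" and nonneg: "\<And>t. 0 \<le> ?d t"
    and d: "integrable lborel ?d"
    and outside: "\<And>t. t \<notin> I \<Longrightarrow> ?d t = 0"
    and ode: "\<And>t. t \<in> interior I \<Longrightarrow> ?d differentiable (at t) \<and>
      poly q t * deriv ?d t = (real k - real n * t) * ?d t"
    and cont: "continuous_on UNIV (\<lambda>t. poly q t * ?d t)"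
    using H unfolding structure_H_def has_bochner_integral_iff by blast+
  have int: "integrable lborel (\<lambda>t. poly s t * ?d t)" if "degree s \<le> N" for s
    using abs_poly_le[OF that] by (intro integrable_moment_bound(1)[OF nonneg d moment]) simp_all
  let ?F = "\<lambda>t. poly (p * q) t * ?d t"
  let ?f = "\<lambda>t. poly (pderiv (p * q)) t * ?d t
    + (real k * (poly p t * ?d t) - real n * (poly (pCons 0 p) t * ?d t))"
  have deg: "degree (pderiv (p * q)) \<le> N" "degree (pCons 0 p) \<le> N" "degree p \<le> N"
    "degree (p * q) \<le> Suc N"
    using N degree_mult_le[of p q] degree_pCons_le[of 0 p] by (auto simp: degree_pderiv)
  have "(\<integral>t. ?f t \<partial>lborel) = 0"
  proof (rule integral_derivative_eq_0[OF finite_frontier_interval[OF I]])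
    have "continuous_on UNIV (\<lambda>t. poly p t * (poly q t * ?d t))"
      by (intro continuous_intros cont)
    then show "continuous_on UNIV ?F" by (simp add: mult.assoc)
    show "integrable lborel ?f"
      by (intro Bochner_Integration.integrable_add Bochner_Integration.integrable_diff
          integrable_mult_right int deg)
    have quotient: "(1 + \<bar>t\<bar> ^ Suc N) / (1 + \<bar>t\<bar>) \<le> 1 + \<bar>t\<bar> ^ N" for t :: real
      by (subst pos_divide_le_eq) (auto simp: algebra_simps add_nonneg_nonneg)
    let ?C = "\<Sum>i\<le>degree (p * q). \<bar>coeff (p * q) i\<bar>"
    have "integrable lborel (\<lambda>t. (poly (p * q) t / (1 + \<bar>t\<bar>)) * ?d t)"
    proof (rule integrable_moment_bound(1)[OF nonneg d moment])
      fix t :: real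
      have "\<bar>poly (p * q) t / (1 + \<bar>t\<bar>)\<bar> \<le> ?C * (1 + \<bar>t\<bar> ^ Suc N) / (1 + \<bar>t\<bar>)"
        using abs_poly_le[OF deg(4), of t] by (simp add: divide_right_mono del: poly_mult)
      also have "\<dots> \<le> ?C * (1 + \<bar>t\<bar> ^ N)"
        using mult_left_mono[OF quotient, of ?C t] by (simp add: sum_nonneg)
      finally show "\<bar>poly (p * q) t / (1 + \<bar>t\<bar>)\<bar> \<le> ?C * (1 + \<bar>t\<bar> ^ N)" .
    qed simp
    then show "integrable lborel (\<lambda>t. ?F t / (1 + \<bar>t\<bar>))" by simp
    show "(?F has_real_derivative ?f t) (at t)" if t: "t \<notin> frontier I" for t
    proof (cases "t \<in> interior I")
      case True
      then have "(?d has_real_derivative deriv ?d t) (at t)"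
        using ode by (simp add: DERIV_deriv_iff_real_differentiable)
      then have "(?F has_real_derivative poly (pderiv (p * q)) t * ?d t + deriv ?d t * poly (p * q) t) (at t)"
        by (rule DERIV_mult[OF poly_DERIV])
      moreover have "deriv ?d t * poly (p * q) t = poly p t * (poly q t * deriv ?d t)"
        by simp
      moreover have "\<dots> = real k * (poly p t * ?d t) - real n * (poly (pCons 0 p) t * ?d t)"
        by (subst conjunct2[OF ode[OF True]]) (simp add: algebra_simps)
      ultimately show ?thesis by (simp only:)
    next
      case False
      then have "t \<notin> closure I" using t by (simp add: frontier_def)
      then have "t \<notin> I" using closure_subset by blast
      have "(?F has_real_derivative 0) (at t)"
      proof (rule has_field_derivative_transform_within_open[OF DERIV_const])
        show "open (- closure I)" "t \<in> - closure I" using \<open>t \<notin> closure I\<close> by auto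
        show "0 = ?F s" if "s \<in> - closure I" for s
          using that outside[of s] closure_subset[of I] by auto
      qed
      then show ?thesis using outside[OF \<open>t \<notin> I\<close>] by simp
    qed
  qed
  also have "(\<integral>t. ?f t \<partial>lborel) = (\<integral>t. poly (pderiv (p * q)) t * ?d t \<partial>lborel)
    + (real k * (\<integral>t. poly p t * ?d t \<partial>lborel) - real n * (\<integral>t. poly (pCons 0 p) t * ?d t \<partial>lborel))"
    using int deg by (simp del: poly_mult poly_pCons)
  finally show ?thesis by simp
qed

subsection \<open>Differentiation with respect to the image of a monotone map\<close>

text \<open>Monotonicity alone suffices. For a in D the value \<open>\<phi> a\<close> separates; for
  a outside the interval D, all of D lies on the same side of a as y0. The limit is stated with
  punctured filters so that difference quotients can be composed with it.\<close>

lemma tendsto_the_inv_into: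
  fixes \<phi> :: "real \<Rightarrow> real"
  assumes D: "is_interval D" and mono: "strict_mono_on D \<phi>" and y0: "y0 \<in> D"
  shows "filterlim (the_inv_into D \<phi>) (at y0 within D) (at (\<phi> y0) within \<phi> ` D)"
proof -
  define g where "g = the_inv_into D \<phi>"
  have inj: "inj_on \<phi> D"
    using mono by (rule strict_mono_on_imp_inj_on)
  have g: "g (\<phi> y) = y" if "y \<in> D" for y
    using inj that by (simp add: g_def the_inv_into_f_f)
  have less: "\<phi> a < \<phi> b \<longleftrightarrow> a < b" if "a \<in> D" "b \<in> D" for a b
    using mono that strict_mono_on_less by blast
  have ev: "eventually (\<lambda>x. x \<in> \<phi> ` D \<and> x \<noteq> \<phi> y0) (at (\<phi> y0) within \<phi> ` D)"
    by (simp add: eventually_at_filter)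
  have "(g \<longlongrightarrow> y0) (at (\<phi> y0) within \<phi> ` D)"
  proof (rule order_tendstoI)
    fix a assume a: "a < y0"
    show "eventually (\<lambda>x. a < g x) (at (\<phi> y0) within \<phi> ` D)"
    proof (cases "a \<in> D")
      case True
      have "eventually (\<lambda>x. \<phi> a < x) (at (\<phi> y0) within \<phi> ` D)"
        using less[OF True y0] a by (intro order_tendstoD(1)[OF tendsto_ident_at]) auto
      with ev show ?thesis
        by eventually_elim (use g less True in auto)
    next
      case False
      have "a < y" if "y \<in> D" for y
        using False D y0 a that by (meson is_interval_1 less_imp_le not_le)
      with ev show ?thesis
        by (auto elim!: eventually_mono simp: g)
    qed
  next
    fix a assume a: "y0 < a"
    show "eventually (\<lambda>x. g x < a) (at (\<phi> y0) within \<phi> ` D)"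
    proof (cases "a \<in> D")
      case True
      have "eventually (\<lambda>x. x < \<phi> a) (at (\<phi> y0) within \<phi> ` D)"
        using less[OF y0 True] a by (intro order_tendstoD(2)[OF tendsto_ident_at]) auto
      with ev show ?thesis
        by eventually_elim (use g less True in auto)
    next
      case False
      have "y < a" if "y \<in> D" for y
        using False D y0 a that by (meson is_interval_1 less_imp_le not_le)
      with ev show ?thesis
        by (auto elim!: eventually_mono simp: g)
    qed
  qed
  moreover have "eventually (\<lambda>x. g x \<in> D \<and> g x \<noteq> y0) (at (\<phi> y0) within \<phi> ` D)"
    using ev by eventually_elim (auto simp: g)
  ultimately show ?thesis
    by (simp add: filterlim_at g_def)
qed

text \<open>The difference quotient of the composite is the quotient of the increments of G and
  \<phi>, taken along the inverse. Hence \<phi> may have derivative 0 at y0, as can happen for x(y)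
  at y = 0.\<close>

lemma has_derivative_compose_inverse:
  fixes \<phi> G :: "real \<Rightarrow> real"
  assumes D: "is_interval D" and mono: "strict_mono_on D \<phi>" and y0: "y0 \<in> D"
    and lim: "((\<lambda>y. (G y - G y0) / (\<phi> y - \<phi> y0)) \<longlongrightarrow> l) (at y0 within D)"
  shows "((\<lambda>x. G (the_inv_into D \<phi> x)) has_real_derivative l) (at (\<phi> y0) within \<phi> ` D)"
proof -
  have g: "the_inv_into D \<phi> (\<phi> y) = y" if "y \<in> D" for y
    using strict_mono_on_imp_inj_on[OF mono] that by (simp add: the_inv_into_f_f)
  have "((\<lambda>x. (G (the_inv_into D \<phi> x) - G y0) / (\<phi> (the_inv_into D \<phi> x) - \<phi> y0)) \<longlongrightarrow> l)
     (at (\<phi> y0) within \<phi> ` D)"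
    by (rule filterlim_compose[OF lim tendsto_the_inv_into[OF D mono y0]])
  moreover have "eventually (\<lambda>x. x \<in> \<phi> ` D) (at (\<phi> y0) within \<phi> ` D)"
    by (simp add: eventually_at_filter)
  then have "eventually (\<lambda>x. (G (the_inv_into D \<phi> x) - G y0) / (\<phi> (the_inv_into D \<phi> x) - \<phi> y0)
      = (G (the_inv_into D \<phi> x) - G (the_inv_into D \<phi> (\<phi> y0))) / (x - \<phi> y0))
      (at (\<phi> y0) within \<phi> ` D)"
    by eventually_elim (auto simp: g y0)
  ultimately show ?thesis
    unfolding has_field_derivative_iff by (rule Lim_transform_eventually)
qed

subsection \<open>Power series in the inverse function\<close>

lemma fps_nth_X_deriv:
  "fps_nth (fps_X * fps_deriv F) k = of_nat k * fps_nth F k"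
  by (cases k) auto

lemma fps_conv_radius_X_deriv:
  fixes F :: "real fps"
  shows "fps_conv_radius F \<le> fps_conv_radius (fps_X * fps_deriv F)"
  using fps_conv_radius_mult[of fps_X "fps_deriv F"] fps_conv_radius_deriv[of F]
  by (simp add: order_trans)

text \<open>In the convolution for the next power, the index i = 0 is covered by the induction
  hypothesis and every other index by the gap of W.\<close>

lemma fps_nth_power_gap:
  fixes W :: "'a::comm_ring_1 fps"
  assumes gap: "\<And>k. 0 < k \<Longrightarrow> k < p \<Longrightarrow> fps_nth W k = 0" and k: "0 < k" "k < p"
  shows "fps_nth (W ^ n) k = 0"
proof (induction n)
  case (Suc n)
  have "fps_nth W i * fps_nth (W ^ n) (k - i) = 0" if "i \<le> k" for i
    using Suc gap[of i] that k by (cases "i = 0") auto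
  then show ?case
    by (simp add: fps_mult_nth)
qed (use k in auto)

lemma fps_split_gap:
  fixes F :: "'a::comm_ring_1 fps"
  assumes "\<And>k. 0 < k \<Longrightarrow> k < p \<Longrightarrow> fps_nth F k = 0" "0 < p"
  shows "F = fps_const (fps_nth F 0) + fps_X ^ p * fps_shift p F"
  using assms by (intro fps_ext) (auto simp: fps_X_power_mult_nth)

lemma eval_fps_split_gap:
  fixes F :: "real fps"
  assumes gap: "\<And>k. 0 < k \<Longrightarrow> k < p \<Longrightarrow> fps_nth F k = 0" "0 < p" and y: "norm y < fps_conv_radius F"
  shows "eval_fps F y = fps_nth F 0 + y ^ p * eval_fps (fps_shift p F) y"
proof -
  have "y ^ p * eval_fps (fps_shift p F) y = eval_fps (fps_X ^ p * fps_shift p F) y"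
    using y by (subst eval_fps_mult) auto
  moreover have "fps_nth F 0 + eval_fps (fps_X ^ p * fps_shift p F) y
      = eval_fps (fps_const (fps_nth F 0) + fps_X ^ p * fps_shift p F) y"
    using y fps_conv_radius_mult[of "fps_X ^ p" "fps_shift p F"]
    by (subst eval_fps_add) (auto intro: less_le_trans)
  ultimately show ?thesis
    using fps_split_gap[OF gap] by simp
qed

section \<open>The map x(y), its monotonicity and its inverse\<close>

locale B_structure =
  fixes W :: "real fps"
  assumes W: "structure_B W"
begin

lemma W_nonneg: "0 \<le> fps_nth W k" and W_nth_0: "0 < fps_nth W 0"
  and W_nonconst: "\<exists>k\<ge>1. 0 < fps_nth W k" and radius_pos: "0 < fps_conv_radius W"
  using W by (auto simp: structure_B_def)

lemma interval_dom: "is_interval (B_dom W)"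
  unfolding is_interval_1 B_dom_def using le_less_trans[of "ereal _" "ereal _"] by auto

lemma zero_in_dom: "0 \<in> B_dom W"
  using radius_pos by (simp add: B_dom_def zero_ereal_def)

lemma dom_nonneg: "y \<in> B_dom W \<Longrightarrow> 0 \<le> y"
  by (simp add: B_dom_def)

lemma dom_radius:
  "fps_conv_radius W \<le> fps_conv_radius F \<Longrightarrow> y \<in> B_dom W \<Longrightarrow> norm y < fps_conv_radius F"
  by (auto simp: B_dom_def intro: less_le_trans)

lemma dom_pos: "\<exists>y\<in>B_dom W. 0 < y"
proof -
  obtain z where "0 < ereal z" "ereal z < fps_conv_radius W"
    using ereal_dense2[OF radius_pos] by blast
  then show ?thesis
    by (intro bexI[of _ z]) (auto simp: B_dom_def)
qed

lemma W_pos: "0 < eval_fps W y" if "y \<in> B_dom W"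
  unfolding eval_fps_def
  using W_nonneg W_nth_0 dom_nonneg[OF that] dom_radius[OF order_refl that]
  by (intro suminf_pos2[where i = 0] summable_fps) auto

lemma B_x_eq:
  assumes "y \<in> B_dom W"
  shows "B_x W y = eval_fps (fps_X * fps_deriv W) y / eval_fps W y"
  using dom_radius[OF order_refl assms] fps_conv_radius_deriv[of W]
  by (subst eval_fps_mult)
     (auto simp: B_x_def eval_fps_deriv[symmetric] intro: less_le_trans)

text \<open>The right-hand side is \<open>\<omega>(y)\<^sup>2\<close> times the variance of the distribution
  with weights \<open>a\<^sub>k y\<^sup>k / \<omega>(y)\<close>.\<close>

lemma variance_pos:
  assumes y: "y \<in> B_dom W" and "0 < y"
  shows "0 < eval_fps W y * eval_fps (fps_X * fps_deriv (fps_X * fps_deriv W)) y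
    - (eval_fps (fps_X * fps_deriv W) y)\<^sup>2"
proof -
  let ?W1 = "fps_X * fps_deriv W"
  let ?W2 = "fps_X * fps_deriv ?W1"
  let ?w = "eval_fps W y" and ?w1 = "eval_fps ?W1 y" and ?w2 = "eval_fps ?W2 y"
  \<comment> \<open>The mean of that distribution; centring at it yields a series of squares (k -
    c)^2 with nonnegative weights.\<close>
  define c where "c = ?w1 / ?w"
  have w: "0 < ?w" by (rule W_pos[OF y])
  have r1: "fps_conv_radius W \<le> fps_conv_radius ?W1"
    by (rule fps_conv_radius_X_deriv)
  have r2: "fps_conv_radius W \<le> fps_conv_radius ?W2"
    using r1 fps_conv_radius_X_deriv[of ?W1] by (rule order_trans)
  have "(\<lambda>k. fps_nth ?W2 k * y ^ k - 2 * c * (fps_nth ?W1 k * y ^ k) + c\<^sup>2 * (fps_nth W k * y ^ k))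
      sums (?w2 - 2 * c * ?w1 + c\<^sup>2 * ?w)"
    by (intro sums_add sums_diff sums_mult sums_eval_fps dom_radius[OF _ y] r1 r2 order_refl)
  moreover have "fps_nth ?W2 k * y ^ k - 2 * c * (fps_nth ?W1 k * y ^ k) + c\<^sup>2 * (fps_nth W k * y ^ k)
      = (real k - c)\<^sup>2 * fps_nth W k * y ^ k" for k
    unfolding fps_nth_X_deriv by (simp add: power2_eq_square algebra_simps)
  ultimately have s: "(\<lambda>k. (real k - c)\<^sup>2 * fps_nth W k * y ^ k) sums (?w2 - 2 * c * ?w1 + c\<^sup>2 * ?w)"
    by simp
  obtain p where p: "p \<ge> 1" "0 < fps_nth W p"
    using W_nonconst by auto
  \<comment> \<open>The indices 0 and p both have positive weight, and c differs from at least one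
    of them.\<close>
  have "\<exists>i. 0 < (real i - c)\<^sup>2 * fps_nth W i * y ^ i"
  proof (cases "c = 0")
    case True
    with p \<open>0 < y\<close> show ?thesis by (intro exI[of _ p]) simp
  next
    case False
    then show ?thesis
      using W_nth_0 by (intro exI[of _ 0]) simp
  qed
  then have "0 < (\<Sum>k. (real k - c)\<^sup>2 * fps_nth W k * y ^ k)"
    using W_nonneg \<open>0 < y\<close> sums_summable[OF s] by (auto intro!: suminf_pos2 simp: less_imp_le)
  then have "0 < ?w2 - 2 * c * ?w1 + c\<^sup>2 * ?w"
    using s by (simp add: sums_iff)
  then have "0 < ?w * (?w2 - 2 * c * ?w1 + c\<^sup>2 * ?w)"
    using w by simp
  also have "\<dots> = ?w * ?w2 - ?w1\<^sup>2"
    using w by (simp add: c_def field_simps power2_eq_square)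
  finally show ?thesis .
qed

text \<open>The product y x'(y) is the variance of the distribution with weights a_k y^k /
  \<omega>(y). At y = 0 the derivative itself may vanish, hence the restriction to y > 0.\<close>

lemma has_derivative_B_x:
  assumes y: "y \<in> B_dom W"
  obtains d where "(B_x W has_real_derivative d) (at y within B_dom W)" "0 < y \<Longrightarrow> 0 < d"
proof -
  let ?W1 = "fps_X * fps_deriv W"
  have r1: "fps_conv_radius W \<le> fps_conv_radius ?W1"
    by (rule fps_conv_radius_X_deriv)
  have r2: "fps_conv_radius W \<le> fps_conv_radius (fps_deriv ?W1)"
    using r1 fps_conv_radius_deriv[of ?W1] by (rule order_trans)
  define d where "d = (eval_fps (fps_deriv ?W1) y * eval_fps W y
    - eval_fps ?W1 y * eval_fps (fps_deriv W) y) / (eval_fps W y * eval_fps W y)"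
  have "((\<lambda>y. eval_fps ?W1 y / eval_fps W y) has_real_derivative d) (at y within B_dom W)"
    unfolding d_def using W_pos[OF y]
    by (intro DERIV_divide has_field_derivative_eval_fps dom_radius[OF _ y] r1 order_refl) auto
  then have "(B_x W has_real_derivative d) (at y within B_dom W)"
    by (rule has_field_derivative_transform_within[OF _ zero_less_one y]) (simp add: B_x_eq)
  moreover have "0 < d" if "0 < y"
  proof -
    have "y * (eval_fps (fps_deriv ?W1) y * eval_fps W y - eval_fps ?W1 y * eval_fps (fps_deriv W) y)
      = eval_fps W y * eval_fps (fps_X * fps_deriv ?W1) y - (eval_fps ?W1 y)\<^sup>2"
      using dom_radius[OF r2 y] dom_radius[OF fps_conv_radius_deriv y]
      by (subst (1 2) eval_fps_mult) (auto simp: algebra_simps power2_eq_square eval_fps_mult)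
    then have "0 < y * (eval_fps (fps_deriv ?W1) y * eval_fps W y
        - eval_fps ?W1 y * eval_fps (fps_deriv W) y)"
      using variance_pos[OF y that] by simp
    then show ?thesis
      using W_pos[OF y] that by (auto simp: d_def zero_less_mult_iff)
  qed
  ultimately show ?thesis by (rule that)
qed

lemma continuous_B_x: "continuous_on (B_dom W) (B_x W)"
  unfolding continuous_on_eq_continuous_within
  by (auto elim!: has_derivative_B_x intro: DERIV_continuous)

text \<open>The derivative can vanish only at 0, which is never strictly between two points of the
  domain.\<close>

lemma strict_mono_B_x: "strict_mono_on (B_dom W) (B_x W)"
proof (rule strict_mono_onI)
  fix a b assume ab: "a \<in> B_dom W" "b \<in> B_dom W" "a < b"
  have sub: "{a..b} \<subseteq> B_dom W"
    using mem_is_interval_1_I[OF interval_dom ab(1,2)] by auto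
  show "B_x W a < B_x W b"
  proof (rule DERIV_pos_imp_increasing_open[OF \<open>a < b\<close>])
    fix x assume x: "a < x" "x < b"
    then have "x \<in> B_dom W" using sub by auto
    moreover have "0 < x" using dom_nonneg[OF ab(1)] x by simp
    ultimately obtain d where "(B_x W has_real_derivative d) (at x within B_dom W)" "0 < d"
      by (auto elim: has_derivative_B_x)
    moreover have "at x within B_dom W = at x"
      using x sub by (intro at_within_nhd[of _ "{a<..<b}"]) auto
    ultimately show "\<exists>y. (B_x W has_real_derivative y) (at x) \<and> 0 < y" by auto
  qed (rule continuous_on_subset[OF continuous_B_x sub])
qed

lemma B_y_B_x: "y \<in> B_dom W \<Longrightarrow> B_y W (B_x W y) = y"
  unfolding B_y_def using strict_mono_on_imp_inj_on[OF strict_mono_B_x] by (rule the_inv_into_f_f)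

lemma B_y_dom: "x \<in> B_X W \<Longrightarrow> B_y W x \<in> B_dom W"
  by (auto simp: B_X_def B_y_B_x)

text \<open>A connected set with more than one point has no isolated points. This makes derivatives
  within \<open>B_X W\<close> unique.\<close>

lemma X_limit_point:
  assumes "x \<in> B_X W"
  shows "at x within B_X W \<noteq> bot"
proof -
  obtain y where y: "y \<in> B_dom W" "0 < y"
    using dom_pos by blast
  then have "B_x W 0 \<in> B_X W" "B_x W y \<in> B_X W" "B_x W 0 \<noteq> B_x W y"
    using zero_in_dom strict_mono_onD[OF strict_mono_B_x, of 0 y] by (auto simp: B_X_def)
  then have "B_X W \<noteq> {z}" for z
    by auto
  moreover have "connected (B_X W)"
    unfolding B_X_def
    using continuous_B_x is_interval_connected[OF interval_dom] by (rule connected_continuous_image)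
  ultimately show ?thesis
    using connected_imp_perfect[of "B_X W" x] assms by (simp add: trivial_limit_within)
qed

text \<open>The inverse has derivative 1 / x'(y), so b(x) = y x'(y), and b(x) d/dx becomes y
  d/dy.\<close>

lemma has_derivative_compose_B_y:
  assumes y: "y \<in> B_dom W" "0 < y"
    and G: "(G has_real_derivative g) (at y within B_dom W)"
  obtains d where "((\<lambda>x. G (B_y W x)) has_real_derivative d) (at (B_x W y) within B_X W)"
    "B_cov W (B_x W y) * d = y * g"
proof -
  obtain d where d: "(B_x W has_real_derivative d) (at y within B_dom W)" "0 < d"
    using y by (auto elim: has_derivative_B_x)
  have chain: "((\<lambda>x. F (B_y W x)) has_real_derivative f / d) (at (B_x W y) within B_X W)"
    if F: "(F has_real_derivative f) (at y within B_dom W)" for F f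
    unfolding B_y_def B_X_def
  proof (rule has_derivative_compose_inverse[OF interval_dom strict_mono_B_x y(1)])
    have "((\<lambda>z. ((F z - F y) / (z - y)) / ((B_x W z - B_x W y) / (z - y))) \<longlongrightarrow> f / d)
        (at y within B_dom W)"
      using F d unfolding has_field_derivative_iff by (intro tendsto_divide) auto
    then show "((\<lambda>z. (F z - F y) / (B_x W z - B_x W y)) \<longlongrightarrow> f / d) (at y within B_dom W)"
      by (rule Lim_transform_eventually) (auto simp: eventually_at_filter)
  qed
  have "B_x W y \<in> B_X W" using y by (simp add: B_X_def)
  then have "vector_derivative (B_y W) (at (B_x W y) within B_X W) = 1 / d"
    using chain[OF DERIV_ident] X_limit_point
    by (intro vector_derivative_within) (auto simp: has_real_derivative_iff_has_vector_derivative)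
  then have "B_cov W (B_x W y) * (g / d) = y * g"
    using y d(2) by (simp add: B_cov_def B_y_B_x)
  with chain[OF G] show ?thesis by (rule that)
qed

text \<open>At \<open>x = 0\<close> the function \<open>y\<close> need not be differentiable.  If \<open>p\<close> is the least positive
  index with \<open>a\<^sub>p \<noteq> 0\<close>, both \<open>x(y)\<close> and the increment of a series whose support lies in that
  of \<open>\<omega>\<^sup>n\<close> are divisible by \<open>y\<^sup>p\<close>, so that their quotient has a limit.\<close>

lemma has_derivative_power_series_of_y_0:
  assumes P: "fps_conv_radius W \<le> fps_conv_radius P"
    and supp: "\<And>k. fps_nth (W ^ n) k = 0 \<Longrightarrow> fps_nth P k = 0"
  obtains d where "((\<lambda>x. eval_fps P (B_y W x) / eval_fps W (B_y W x) ^ n) has_real_derivative d)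
    (at (B_x W 0) within B_X W)"
proof -
  define p where "p = (LEAST k. 1 \<le> k \<and> 0 < fps_nth W k)"
  have p: "1 \<le> p" "0 < fps_nth W p"
    using LeastI_ex[OF W_nonconst[unfolded Bex_def]] by (auto simp: p_def)
  have gapW: "fps_nth W k = 0" if "0 < k" "k < p" for k
    using not_less_Least[of k "\<lambda>k. 1 \<le> k \<and> 0 < fps_nth W k"] W_nonneg[of k] that
    by (auto simp: p_def)
  let ?B = "W ^ n" and ?W1 = "fps_X * fps_deriv W"
  have gapB: "fps_nth ?B k = 0" if "0 < k" "k < p" for k
    using fps_nth_power_gap[OF gapW that] by simp
  have gapP: "fps_nth P k = 0" if "0 < k" "k < p" for k
    using supp gapB that by simp
  have gapW1: "fps_nth ?W1 k = 0" if "0 < k" "k < p" for k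
    unfolding fps_nth_X_deriv using gapW that by simp
  have rB: "fps_conv_radius W \<le> fps_conv_radius ?B"
    by (rule fps_conv_radius_power)
  have r1: "fps_conv_radius W \<le> fps_conv_radius ?W1"
    by (rule fps_conv_radius_X_deriv)
  have "0 < p" using p by simp
  let ?w = "eval_fps W" and ?b0 = "fps_nth ?B 0" and ?P0 = "fps_nth P 0"
  let ?sP = "eval_fps (fps_shift p P)" and ?sB = "eval_fps (fps_shift p ?B)"
  let ?sW = "eval_fps (fps_shift p ?W1)"
  have b0: "0 < ?b0"
    using W_nth_0 by (simp add: fps_nth_power_0)
  let ?G = "\<lambda>y. eval_fps P y / ?w y ^ n"
  \<comment> \<open>The difference quotient of \<open>?G\<close> against x(y) with the common factor
    y^p cancelled; in this form it makes sense and is continuous at 0.\<close>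
  let ?Q = "\<lambda>y. ((?sP y * ?b0 - ?P0 * ?sB y) / (?w y ^ n * ?b0)) / (?sW y / ?w y)"
  have cont: "(eval_fps F \<longlongrightarrow> eval_fps F 0) (at 0 within B_dom W)"
    if "fps_conv_radius W \<le> fps_conv_radius F" for F
    using continuous_eval_fps[of 0 F "B_dom W"] dom_radius[OF that zero_in_dom]
    by (auto simp: continuous_within)
  \<comment> \<open>The value at 0 is p a_p.\<close>
  have "?sW 0 \<noteq> 0"
    using p by (simp add: eval_fps_at_0 fps_nth_X_deriv del: fps_mult_fps_X_deriv_shift)
  then have "(?Q \<longlongrightarrow> ?Q 0) (at 0 within B_dom W)"
    using W_pos[OF zero_in_dom] W_nth_0 b0 P rB r1
    by (intro tendsto_divide tendsto_diff tendsto_mult tendsto_const cont tendsto_power) auto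
  moreover have "eventually (\<lambda>y. ?Q y = (?G y - ?G 0) / (B_x W y - B_x W 0)) (at 0 within B_dom W)"
    unfolding eventually_at_filter
  proof (rule always_eventually, safe)
    fix y assume y: "y \<in> B_dom W" "y \<noteq> 0"
    have wp: "0 < ?w y" by (rule W_pos[OF y(1)])
    have Bp: "?w y ^ n = ?b0 + y ^ p * ?sB y"
      using eval_fps_split_gap[OF gapB \<open>0 < p\<close> dom_radius[OF rB y(1)]]
        eval_fps_power[of y W n] dom_radius[OF order_refl y(1)] by simp
    have Pp: "eval_fps P y = ?P0 + y ^ p * ?sP y"
      by (rule eval_fps_split_gap[OF gapP \<open>0 < p\<close> dom_radius[OF P y(1)]])
    have Wp: "eval_fps ?W1 y = y ^ p * ?sW y"
      using eval_fps_split_gap[OF gapW1 \<open>0 < p\<close> dom_radius[OF r1 y(1)]] by simp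
    have x: "B_x W y - B_x W 0 = y ^ p * (?sW y / ?w y)"
      unfolding B_x_eq[OF y(1)] Wp by (simp add: B_x_def)
    have "?G 0 = ?P0 / ?b0"
      by (simp add: eval_fps_at_0 fps_nth_power_0)
    then have "?G y - ?G 0 = (eval_fps P y * ?b0 - ?P0 * ?w y ^ n) / (?w y ^ n * ?b0)"
      using b0 wp W_nth_0 diff_frac_eq[of "?w y ^ n" ?b0 "eval_fps P y" ?P0] by simp
    also have "eval_fps P y * ?b0 - ?P0 * ?w y ^ n = y ^ p * (?sP y * ?b0 - ?P0 * ?sB y)"
      unfolding Bp Pp by (simp add: algebra_simps)
    finally show "?Q y = (?G y - ?G 0) / (B_x W y - B_x W 0)"
      unfolding x using y(2) by simp
  qed
  ultimately have "((\<lambda>y. (?G y - ?G 0) / (B_x W y - B_x W 0)) \<longlongrightarrow> ?Q 0) (at 0 within B_dom W)"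
    by (rule Lim_transform_eventually)
  from has_derivative_compose_inverse[OF interval_dom strict_mono_B_x zero_in_dom this]
  show ?thesis
    unfolding B_y_def[symmetric] B_X_def[symmetric] by (rule that)
qed

text \<open>For y > 0 the operator b(x) d/dx is y d/dy, and differentiating the denominator
  \<omega>^n contributes the factor n y \<omega>'(y) / \<omega>(y) = n x. At y = 0 both sides of the
  second claim are 0.\<close>

lemma has_derivative_power_series_of_y:
  assumes P: "fps_conv_radius W \<le> fps_conv_radius P"
    and supp: "\<And>k. fps_nth (W ^ n) k = 0 \<Longrightarrow> fps_nth P k = 0"
    and x: "x \<in> B_X W"
  obtains d where
    "((\<lambda>x. eval_fps P (B_y W x) / eval_fps W (B_y W x) ^ n) has_real_derivative d) (at x within B_X W)"
    "B_cov W x * d = eval_fps (fps_X * fps_deriv P) (B_y W x) / eval_fps W (B_y W x) ^ n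
      - real n * x * (eval_fps P (B_y W x) / eval_fps W (B_y W x) ^ n)"
proof -
  obtain y where y: "y \<in> B_dom W" and xy: "x = B_x W y"
    using x by (auto simp: B_X_def)
  have eP: "eval_fps (fps_X * fps_deriv P) y = y * eval_fps (fps_deriv P) y"
    using dom_radius[OF order_trans[OF P fps_conv_radius_deriv] y] by (subst eval_fps_mult) auto
  show ?thesis
  proof (cases "y = 0")
    case True
    obtain d where "((\<lambda>x. eval_fps P (B_y W x) / eval_fps W (B_y W x) ^ n) has_real_derivative d)
      (at (B_x W 0) within B_X W)"
      using has_derivative_power_series_of_y_0[OF P supp] by blast
    moreover have "B_y W (B_x W 0) = 0" "B_x W 0 = 0"
      by (rule B_y_B_x[OF zero_in_dom]) (simp add: B_x_def)
    ultimately show ?thesis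
      using that[of d] eP by (simp add: xy True B_cov_def)
  next
    case False
    then have "0 < y" using dom_nonneg[OF y] by simp
    let ?w = "eval_fps W y" and ?w' = "eval_fps (fps_deriv W) y"
    let ?g = "(eval_fps (fps_deriv P) y * ?w ^ n - eval_fps P y * (real n * (?w' * ?w ^ (n - 1))))
      / (?w ^ n * ?w ^ n)"
    have w: "0 < ?w" by (rule W_pos[OF y])
    have G: "((\<lambda>y. eval_fps P y / eval_fps W y ^ n) has_real_derivative ?g) (at y within B_dom W)"
      using w DERIV_power[OF has_field_derivative_eval_fps[OF dom_radius[OF order_refl y]], of n]
      by (intro DERIV_divide has_field_derivative_eval_fps dom_radius[OF P y])
         (auto simp: algebra_simps)
    obtain d where d: "((\<lambda>x. eval_fps P (B_y W x) / eval_fps W (B_y W x) ^ n)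
        has_real_derivative d) (at x within B_X W)" "B_cov W x * d = y * ?g"
      unfolding xy by (rule has_derivative_compose_B_y[OF y \<open>0 < y\<close> G])
    have "deriv (eval_fps W) y = ?w'"
      using dom_radius[OF order_refl y] by (simp add: eval_fps_deriv)
    then have x: "x = y * ?w' / ?w"
      by (simp add: xy B_x_def)
    \<comment> \<open>For n = 0 the exponent n - 1 is truncated, but it stands next to the factor
      n.\<close>
    have "y * ?g = y * eval_fps (fps_deriv P) y / ?w ^ n - real n * x * (eval_fps P y / ?w ^ n)"
      unfolding x using w by (cases n) (simp_all add: field_simps)
    with d show ?thesis
      using that[of d] eP y by (simp add: xy B_y_B_x)
  qed
qed

end

subsection \<open>Expectations of polynomials\<close>

text \<open>Maclaurin's formula for q(a + s): the remainder contains the derivative of order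
  \<open>degree q\<close> + 1, which is 0.\<close>

lemma poly_taylor:
  fixes q :: "real poly"
  shows "q = (\<Sum>i=0..degree q. smult (poly ((pderiv ^^ i) q) a / fact i) ([:- a, 1:] ^ i))"
proof (rule poly_ext)
  fix t
  let ?diff = "\<lambda>i s. poly ((pderiv ^^ i) q) (a + s)"
  have "\<forall>i s. (?diff i has_real_derivative ?diff (Suc i) s) (at s)"
    by (auto intro!: derivative_eq_intros DERIV_chain2[OF poly_DERIV])
  from Maclaurin_all_le[where n = "Suc (degree q)" and x = "t - a", OF refl this]
  obtain s where "poly q t = (\<Sum>i<Suc (degree q). poly ((pderiv ^^ i) q) a / fact i * (t - a) ^ i)
      + ?diff (Suc (degree q)) s / fact (Suc (degree q)) * (t - a) ^ Suc (degree q)"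
    by auto
  moreover have "degree ((pderiv ^^ degree q) q) = 0"
    by (simp add: degree_higher_pderiv)
  then have "(pderiv ^^ Suc (degree q)) q = 0"
    by (simp add: pderiv_eq_0_iff)
  ultimately show "poly q t = poly (\<Sum>i=0..degree q. smult (poly ((pderiv ^^ i) q) a / fact i) ([:- a, 1:] ^ i)) t"
    by (simp add: poly_sum lessThan_Suc_atMost atLeast0AtMost)
qed

lemma higher_deriv_poly:
  fixes q :: "real poly"
  shows "(deriv ^^ i) (poly q) = poly ((pderiv ^^ i) q)"
proof (induction i)
  case (Suc i)
  have "deriv (poly p) = poly (pderiv p)" for p :: "real poly"
    by (intro ext DERIV_imp_deriv poly_DERIV)
  with Suc show ?case by simp
qed simp

text \<open>With the polynomial as an argument of its own, a central moment depends on x separately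
  through the weights and through the centre \<alpha>(x).\<close>

definition phillips_expectation ::
  "real fps \<Rightarrow> (nat \<Rightarrow> nat \<Rightarrow> real \<Rightarrow> real) \<Rightarrow> nat \<Rightarrow> real \<Rightarrow> real poly \<Rightarrow> real" where
  "phillips_expectation W den n x p = (\<Sum>k. B_prob W n k x * (\<integral>t. poly p t * den n k t \<partial>lborel))"

lemma phillips_mean_eq: "phillips_mean W den n x = phillips_expectation W den n x [:0, 1:]"
  by (simp add: phillips_mean_def phillips_expectation_def)

lemma phillips_central_moment_eq:
  "phillips_central_moment W den n m x
    = phillips_expectation W den n x ([:- phillips_mean W den n x, 1:] ^ m)"
  by (simp add: phillips_central_moment_def phillips_expectation_def)

section \<open>Expectations under the mixture as power series in y\<close>

locale phillips = B_structure +
  fixes den :: "nat \<Rightarrow> nat \<Rightarrow> real \<Rightarrow> real" and n N :: nat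
  assumes den_nonneg: "\<And>k t. 0 \<le> den n k t"
    and den_integral: "\<And>k. has_bochner_integral lborel (den n k) 1"
    and moment: "\<And>z. z \<in> B_X W \<Longrightarrow> integrable lborel (\<lambda>t. t ^ N * phillips_density W den n z t)"
begin

abbreviation E :: "real \<Rightarrow> real poly \<Rightarrow> real" where
  "E \<equiv> phillips_expectation W den n"

abbreviation \<Lambda> :: "nat \<Rightarrow> real poly \<Rightarrow> real" where
  "\<Lambda> k p \<equiv> (\<integral>t. poly p t * den n k t \<partial>lborel)"

text \<open>The generating function whose quotient by \<omega>(y)^n is the expectation of p, for p
  of degree at most N.\<close>

definition moment_series :: "real poly \<Rightarrow> real fps" where
  "moment_series p = Abs_fps (\<lambda>k. fps_nth (W ^ n) k * \<Lambda> k p)"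

lemma den_integrable: "integrable lborel (den n k)" and den_integral_1: "(\<integral>t. den n k t \<partial>lborel) = 1"
  using den_integral by (auto simp: has_bochner_integral_iff)

lemma power_nth_nonneg: "0 \<le> fps_nth (W ^ i) k"
proof (induction i arbitrary: k)
  case (Suc i)
  then show ?case
    using W_nonneg by (auto simp: fps_mult_nth intro!: sum_nonneg mult_nonneg_nonneg)
qed simp

lemma B_prob_B_x:
  "y \<in> B_dom W \<Longrightarrow> B_prob W n k (B_x W y) = fps_nth (W ^ n) k * y ^ k / eval_fps W y ^ n"
  by (simp add: B_prob_def B_y_B_x)

text \<open>The moment hypothesis at z = x(y), distributed over the components and cleared of the
  denominator \<omega>(y)^n.\<close>

lemma summable_moments:
  assumes y: "y \<in> B_dom W"
  defines "c k \<equiv> fps_nth (W ^ n) k * y ^ k"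
  shows "integrable lborel (\<lambda>t. \<bar>t\<bar> ^ N * (c k * den n k t))"
    and "summable (\<lambda>k. c k * (1 + (\<integral>t. \<bar>t\<bar> ^ N * den n k t \<partial>lborel)))"
proof -
  let ?w = "eval_fps W y ^ n"
  let ?g = "\<lambda>k t. B_prob W n k (B_x W y) * den n k t"
  have w: "0 < ?w"
    using W_pos[OF y] by simp
  have c: "0 \<le> c k" "B_prob W n k (B_x W y) = c k / ?w" for k
    using power_nth_nonneg dom_nonneg[OF y] by (simp_all add: c_def B_prob_B_x[OF y])
  have sc: "summable c"
    unfolding c_def using dom_radius[OF fps_conv_radius_power y] by (rule summable_fps)
  have nonneg: "0 \<le> ?g k t" for k t
    using c w den_nonneg by simp
  have int: "integrable lborel (?g k)" for k
    using den_integrable by simp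
  have sum: "summable (\<lambda>k. \<integral>t. ?g k t \<partial>lborel)"
    using summable_divide[OF sc, of ?w] by (simp add: c den_integral_1)
  have "integrable lborel (\<lambda>t. t ^ N * (\<Sum>k. ?g k t))"
    using moment[of "B_x W y"] y by (simp add: phillips_density_def B_X_def)
  note weighted = summable_weighted_integrals[OF nonneg int sum _ this]
  have eq: "(\<lambda>t. \<bar>t\<bar> ^ N * (c k * den n k t)) = (\<lambda>t. ?w * (\<bar>t ^ N\<bar> * ?g k t))" for k
    using W_pos[OF y] by (simp add: c power_abs)
  show "integrable lborel (\<lambda>t. \<bar>t\<bar> ^ N * (c k * den n k t))"
    unfolding eq using weighted(1) by (intro integrable_mult_right) simp
  have "?w * (\<integral>t. \<bar>t ^ N\<bar> * ?g k t \<partial>lborel) = (\<integral>t. \<bar>t\<bar> ^ N * (c k * den n k t) \<partial>lborel)" for k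
    unfolding eq by (rule integral_mult_right_zero[symmetric])
  moreover have "(\<integral>t. \<bar>t\<bar> ^ N * (c k * den n k t) \<partial>lborel) = c k * (\<integral>t. \<bar>t\<bar> ^ N * den n k t \<partial>lborel)" for k
    unfolding mult.left_commute[of _ "c k"] by (rule integral_mult_right_zero)
  moreover have "summable (\<lambda>k. ?w * (\<integral>t. \<bar>t ^ N\<bar> * ?g k t \<partial>lborel))"
    using weighted(2) by (intro summable_mult) simp
  ultimately have "summable (\<lambda>k. c k * (\<integral>t. \<bar>t\<bar> ^ N * den n k t \<partial>lborel))"
    by simp
  from summable_add[OF sc this] show "summable (\<lambda>k. c k * (1 + (\<integral>t. \<bar>t\<bar> ^ N * den n k t \<partial>lborel)))"
    by (simp add: distrib_left)
qed

text \<open>The mixture controls the k-th density only where its weight is nonzero; for y > 0 one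
  can then divide by the weight.\<close>

lemma moment_integrable:
  assumes "fps_nth (W ^ n) k \<noteq> 0"
  shows "integrable lborel (\<lambda>t. \<bar>t\<bar> ^ N * den n k t)"
proof -
  obtain y where y: "y \<in> B_dom W" "0 < y"
    using dom_pos by blast
  let ?c = "fps_nth (W ^ n) k * y ^ k"
  have "integrable lborel (\<lambda>t. ?c * (\<bar>t\<bar> ^ N * den n k t))"
    using summable_moments(1)[OF y(1), of k] by (simp only: mult.left_commute[of _ ?c])
  moreover have "?c \<noteq> 0"
    using assms y(2) by simp
  ultimately show ?thesis
    by (simp only: integrable_mult_left_iff) blast
qed

lemma poly_integrable:
  assumes "fps_nth (W ^ n) k \<noteq> 0" "degree p \<le> N"
  shows "integrable lborel (\<lambda>t. poly p t * den n k t)"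
  using abs_poly_le[OF assms(2)]
  by (intro integrable_moment_bound(1)[OF den_nonneg den_integrable moment_integrable[OF assms(1)]]) auto

text \<open>Each r in (0, R) is itself a value of y at which the mixture has a finite N-th moment,
  and this moment dominates the series at r.\<close>

lemma radius_moment_series:
  assumes p: "degree p \<le> N"
  shows "fps_conv_radius W \<le> fps_conv_radius (moment_series p)"
  unfolding fps_conv_radius_def
proof (rule conv_radius_geI_ex)
  fix r :: real
  assume "0 < r" "ereal r < conv_radius (fps_nth W)"
  then have y: "r \<in> B_dom W"
    by (simp add: B_dom_def fps_conv_radius_def)
  define C where "C = (\<Sum>i\<le>degree p. \<bar>coeff p i\<bar>)"
  let ?c = "\<lambda>k. fps_nth (W ^ n) k * r ^ k"
  let ?m = "\<lambda>k. \<integral>t. \<bar>t\<bar> ^ N * den n k t \<partial>lborel"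
  have le: "norm (fps_nth (moment_series p) k * r ^ k) \<le> C * (?c k * (1 + ?m k))" for k
  proof (cases "fps_nth (W ^ n) k = 0")
    case False
    have "\<bar>\<Lambda> k p\<bar> \<le> C * (1 + ?m k)"
      using integrable_moment_bound(2)[OF den_nonneg den_integrable moment_integrable[OF False],
          of "poly p" C] abs_poly_le[OF p]
      by (simp add: C_def den_integral_1)
    then have "?c k * \<bar>\<Lambda> k p\<bar> \<le> ?c k * (C * (1 + ?m k))"
      using power_nth_nonneg[of n k] \<open>0 < r\<close> by (intro mult_left_mono mult_nonneg_nonneg) auto
    moreover have "norm (fps_nth (moment_series p) k * r ^ k) = ?c k * \<bar>\<Lambda> k p\<bar>"
      using power_nth_nonneg[of n k] \<open>0 < r\<close> by (simp add: moment_series_def abs_mult)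
    ultimately show ?thesis
      by (simp only: mult.left_commute[of C])
  qed (simp add: moment_series_def)
  have "summable (\<lambda>k. C * (?c k * (1 + ?m k)))"
    using summable_moments(2)[OF y] by (rule summable_mult)
  then have "summable (\<lambda>k. fps_nth (moment_series p) k * r ^ k)"
    using le by (rule summable_comparison_test'[where N = 0])
  then show "\<exists>z. norm z = r \<and> summable (\<lambda>k. fps_nth (moment_series p) k * z ^ k)"
    using \<open>0 < r\<close> by (intro exI[of _ r]) simp
qed

lemma expectation_sums:
  assumes p: "degree p \<le> N" and x: "x \<in> B_X W"
  shows "(\<lambda>k. B_prob W n k x * \<Lambda> k p) sums
    (eval_fps (moment_series p) (B_y W x) / eval_fps W (B_y W x) ^ n)"
  using sums_divide[OF sums_eval_fps[OF dom_radius[OF radius_moment_series[OF p] B_y_dom[OF x]]],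
      of "eval_fps W (B_y W x) ^ n"]
  by (simp add: moment_series_def B_prob_def mult.commute mult.left_commute)

lemma expectation_eq:
  assumes "degree p \<le> N" "x \<in> B_X W"
  shows "E x p = eval_fps (moment_series p) (B_y W x) / eval_fps W (B_y W x) ^ n"
  using expectation_sums[OF assms] by (simp add: phillips_expectation_def sums_iff)

text \<open>Where the coefficient of \<open>W ^ n\<close> vanishes, the weight is 0 and
  integrability may fail harmlessly; elsewhere the integral is linear.\<close>

lemma expectation_sum:
  assumes J: "finite J" "\<And>j. j \<in> J \<Longrightarrow> degree (f j) \<le> N" and x: "x \<in> B_X W"
  shows "E x (\<Sum>j\<in>J. smult (c j) (f j)) = (\<Sum>j\<in>J. c j * E x (f j))"
proof -
  have "B_prob W n k x * \<Lambda> k (\<Sum>j\<in>J. smult (c j) (f j))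
      = (\<Sum>j\<in>J. c j * (B_prob W n k x * \<Lambda> k (f j)))" for k
  proof (cases "fps_nth (W ^ n) k = 0")
    case False
    have "\<Lambda> k (\<Sum>j\<in>J. smult (c j) (f j)) = (\<integral>t. (\<Sum>j\<in>J. c j * (poly (f j) t * den n k t)) \<partial>lborel)"
      by (simp add: poly_sum sum_distrib_right mult.assoc)
    also have "\<dots> = (\<Sum>j\<in>J. c j * \<Lambda> k (f j))"
      using poly_integrable[OF False J(2)] by (subst Bochner_Integration.integral_sum) auto
    finally show ?thesis
      by (simp add: sum_distrib_left mult.left_commute)
  qed (simp add: B_prob_def)
  moreover have "(\<lambda>k. B_prob W n k x * \<Lambda> k (f j)) sums E x (f j)" if "j \<in> J" for j
    unfolding expectation_eq[OF J(2)[OF that] x] by (rule expectation_sums[OF J(2)[OF that] x])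
  then have "(\<lambda>k. \<Sum>j\<in>J. c j * (B_prob W n k x * \<Lambda> k (f j))) sums (\<Sum>j\<in>J. c j * E x (f j))"
    by (intro sums_sum sums_mult)
  ultimately show ?thesis
    by (simp add: phillips_expectation_def sums_iff)
qed

lemma has_derivative_expectation:
  assumes p: "degree p \<le> N" and x: "x \<in> B_X W"
  obtains d where "((\<lambda>x. E x p) has_real_derivative d) (at x within B_X W)"
    "B_cov W x * d = eval_fps (fps_X * fps_deriv (moment_series p)) (B_y W x) / eval_fps W (B_y W x) ^ n
      - real n * x * E x p"
proof -
  obtain d where d: "((\<lambda>x. eval_fps (moment_series p) (B_y W x) / eval_fps W (B_y W x) ^ n)
      has_real_derivative d) (at x within B_X W)"
    "B_cov W x * d = eval_fps (fps_X * fps_deriv (moment_series p)) (B_y W x) / eval_fps W (B_y W x) ^ n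
      - real n * x * (eval_fps (moment_series p) (B_y W x) / eval_fps W (B_y W x) ^ n)"
    using has_derivative_power_series_of_y[OF radius_moment_series[OF p] _ x]
    by (force simp: moment_series_def)
  show ?thesis
  proof (rule that)
    show "((\<lambda>x. E x p) has_real_derivative d) (at x within B_X W)"
      by (rule has_field_derivative_transform_within[OF d(1) zero_less_one x])
         (simp add: expectation_eq[OF p])
  qed (use d(2) expectation_eq[OF p x] in simp)
qed

text \<open>The operator y d/dy multiplies the k-th coefficient by k, and integration by parts
  against the k-th density rewrites this product. Coefficients with vanishing weight are 0 on both
  sides.\<close>

lemma eval_X_deriv_moment_series:
  assumes H: "structure_H (poly q) I den n"
    and deg: "degree p + 1 \<le> N" "degree p + degree q \<le> N + 1" and x: "x \<in> B_X W"
  shows "eval_fps (fps_X * fps_deriv (moment_series p)) (B_y W x) / eval_fps W (B_y W x) ^ n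
    = real n * E x (pCons 0 p) - E x (pderiv (p * q))"
proof -
  let ?y = "B_y W x"
  have deg': "degree p \<le> N" "degree (pCons 0 p) \<le> N" "degree (pderiv (p * q)) \<le> N"
    using deg degree_mult_le[of p q] degree_pCons_le[of 0 p] by (auto simp: degree_pderiv)
  have "fps_X * fps_deriv (moment_series p)
      = fps_const (real n) * moment_series (pCons 0 p) - moment_series (pderiv (p * q))"
  proof (rule fps_ext)
    fix k
    show "fps_nth (fps_X * fps_deriv (moment_series p)) k
      = fps_nth (fps_const (real n) * moment_series (pCons 0 p) - moment_series (pderiv (p * q))) k"
    proof (cases "fps_nth (W ^ n) k = 0")
      case False
      have "real k * (fps_nth (W ^ n) k * \<Lambda> k p) = fps_nth (W ^ n) k * (real k * \<Lambda> k p)"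
        by simp
      also have "\<dots> = fps_nth (W ^ n) k
          * (real n * \<Lambda> k (pCons 0 p) - \<Lambda> k (pderiv (p * q)))"
        by (simp only: integral_poly_density_by_parts[OF H moment_integrable[OF False] deg])
      finally show ?thesis
        by (simp only: fps_nth_X_deriv moment_series_def fps_sub_nth fps_mult_left_const_nth
            fps_nth_Abs_fps right_diff_distrib mult.left_commute)
    qed (simp add: fps_nth_X_deriv moment_series_def del: fps_mult_fps_X_deriv_shift)
  qed
  moreover note radius = dom_radius[OF radius_moment_series B_y_dom[OF x]]
  have "norm ?y < fps_conv_radius (fps_const (real n) * moment_series (pCons 0 p))"
    using radius[OF deg'(2)] fps_conv_radius_mult[of "fps_const (real n)" "moment_series (pCons 0 p)"]
    by (auto intro: less_le_trans)
  ultimately show ?thesis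
    using radius[OF deg'(2)] radius[OF deg'(3)]
    by (simp add: expectation_eq[OF deg'(2) x] expectation_eq[OF deg'(3) x] eval_fps_diff eval_fps_mult diff_divide_distrib)
qed

text \<open>The coefficients of \<open>(t - \<alpha>(x))\<^sup>m\<close> depend on \<open>x\<close>; differentiating them produces the
  term with \<open>\<alpha>'\<close>, and the remaining part is the derivative of the expectation of the fixed
  polynomial \<open>(t - \<alpha>(x\<^sub>0))\<^sup>m\<close>.\<close>

lemma has_derivative_central_moment:
  assumes m: "m \<le> N" and x: "x \<in> B_X W"
    and \<alpha>: "(\<alpha> has_real_derivative \<alpha>') (at x within B_X W)"
    and d: "((\<lambda>z. E z ([:- \<alpha> x, 1:] ^ m)) has_real_derivative d) (at x within B_X W)"
  shows "((\<lambda>z. E z ([:- \<alpha> z, 1:] ^ m)) has_real_derivative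
    d - real m * \<alpha>' * E x ([:- \<alpha> x, 1:] ^ (m - 1))) (at x within B_X W)"
proof -
  \<comment> \<open>In monomials the expectation becomes a finite sum of products: a power of
    \<alpha>(z) times the expectation of a fixed monomial. The product rule applies to each.\<close>
  have expand: "[:- a, 1:] ^ i = (\<Sum>j\<le>i. smult (real (i choose j) * (- a) ^ (i - j)) (monom 1 j))" for a :: real and i
  proof (rule poly_ext)
    fix t
    show "poly ([:- a, 1:] ^ i) t = poly (\<Sum>j\<le>i. smult (real (i choose j) * (- a) ^ (i - j)) (monom 1 j)) t"
      using binomial_ring[of t "- a" i]
      by (simp add: poly_sum poly_monom mult.commute mult.left_commute)
  qed
  have E_expand: "E z ([:- a, 1:] ^ i) = (\<Sum>j\<le>i. real (i choose j) * (- a) ^ (i - j) * E z (monom 1 j))"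
    if "i \<le> N" "z \<in> B_X W" for a z i
    unfolding expand using that by (intro expectation_sum) (auto intro: order_trans[OF degree_monom_le])
  have "\<exists>D. \<forall>j\<le>m. ((\<lambda>z. E z (monom 1 j)) has_real_derivative D j) (at x within B_X W)"
    using has_derivative_expectation[OF _ x] m
    by (intro choice allI) (metis degree_monom_le order_trans)
  then obtain D where D: "\<And>j. j \<le> m \<Longrightarrow> ((\<lambda>z. E z (monom 1 j)) has_real_derivative D j) (at x within B_X W)"
    by blast
  have "((\<lambda>z. \<Sum>j\<le>m. real (m choose j) * (- \<alpha> x) ^ (m - j) * E z (monom 1 j)) has_real_derivative
      (\<Sum>j\<le>m. real (m choose j) * (- \<alpha> x) ^ (m - j) * D j)) (at x within B_X W)"
    by (intro DERIV_sum DERIV_cmult D) auto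
  then have "((\<lambda>z. E z ([:- \<alpha> x, 1:] ^ m)) has_real_derivative
      (\<Sum>j\<le>m. real (m choose j) * (- \<alpha> x) ^ (m - j) * D j)) (at x within B_X W)"
    by (rule has_field_derivative_transform_within[OF _ zero_less_one x]) (simp add: E_expand[OF m])
  then have d_eq: "d = (\<Sum>j\<le>m. real (m choose j) * (- \<alpha> x) ^ (m - j) * D j)"
    using d X_limit_point[OF x] vector_derivative_unique_within
    unfolding has_real_derivative_iff_has_vector_derivative by blast
  have pow: "((\<lambda>z. (- \<alpha> z) ^ i) has_real_derivative real i * (- \<alpha>' * (- \<alpha> x) ^ (i - 1)))
      (at x within B_X W)" for i
    using DERIV_power[OF DERIV_minus[OF \<alpha>], of i] by simp
  let ?c' = "\<lambda>j. real (m choose j) * (real (m - j) * (- \<alpha>' * (- \<alpha> x) ^ (m - j - 1)))"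
  have "((\<lambda>z. \<Sum>j\<le>m. real (m choose j) * (- \<alpha> z) ^ (m - j) * E z (monom 1 j)) has_real_derivative
      (\<Sum>j\<le>m. ?c' j * E x (monom 1 j) + D j * (real (m choose j) * (- \<alpha> x) ^ (m - j)))) (at x within B_X W)"
    by (intro DERIV_sum DERIV_mult DERIV_cmult D pow) auto
  also have "(\<Sum>j\<le>m. ?c' j * E x (monom 1 j) + D j * (real (m choose j) * (- \<alpha> x) ^ (m - j)))
      = d + (\<Sum>j\<le>m. ?c' j * E x (monom 1 j))"
    by (simp only: d_eq sum.distrib mult.commute[of "D _"] add.commute)
  \<comment> \<open>The absorption identity (m - j) (m choose j) = m (m - 1 choose j) recovers the
    binomial expansion of degree m - 1; for m = 0 both sides are 0.\<close>
  also have "(\<Sum>j\<le>m. ?c' j * E x (monom 1 j)) = - (real m * \<alpha>' * E x ([:- \<alpha> x, 1:] ^ (m - 1)))"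
  proof (cases m)
    case (Suc l)
    have "?c' j * E x (monom 1 j)
        = - (real m * \<alpha>') * (real (l choose j) * (- \<alpha> x) ^ (l - j) * E x (monom 1 j))" for j
    proof -
      have "real (Suc l choose j) * real (Suc l - j) = real (Suc l) * real (l choose j)"
        by (simp only: of_nat_mult[symmetric] mult.commute[of "Suc l choose j"]
            binomial_absorb_comp diff_Suc_1)
      moreover have "?c' j * E x (monom 1 j)
          = (real (Suc l choose j) * real (Suc l - j)) * (- \<alpha>' * (- \<alpha> x) ^ (l - j) * E x (monom 1 j))"
        by (simp add: Suc del: of_nat_diff binomial_Suc_Suc)
      ultimately show ?thesis
        by (simp only: Suc) simp
    qed
    then have "(\<Sum>j\<le>m. ?c' j * E x (monom 1 j)) = - (real m * \<alpha>')
        * (\<Sum>j\<le>m. real (l choose j) * (- \<alpha> x) ^ (l - j) * E x (monom 1 j))"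
      by (simp only: sum_distrib_left)
    \<comment> \<open>The surplus index j = m = l + 1 contributes 0, as its binomial coefficient
      vanishes.\<close>
    also have "(\<Sum>j\<le>m. real (l choose j) * (- \<alpha> x) ^ (l - j) * E x (monom 1 j))
        = E x ([:- \<alpha> x, 1:] ^ (m - 1))"
      using m E_expand[of l x "\<alpha> x"] x by (simp add: Suc)
    finally show ?thesis
      by (simp only: mult_minus_left)
  qed simp
  finally show ?thesis
    unfolding diff_conv_add_uminus
    by (rule has_field_derivative_transform_within[OF _ zero_less_one x]) (simp add: E_expand[OF m])
qed

end

section \<open>The recurrence for the central moments\<close>

theorem theorem1:
  fixes W :: "real fps"
    and h :: "real \<Rightarrow> real" and I :: "real set" and den :: "nat \<Rightarrow> nat \<Rightarrow> real \<Rightarrow> real"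
    and q :: "real poly" and r n m :: nat and x :: real
  defines "\<alpha> \<equiv> phillips_mean W den n"
    and "\<mu> \<equiv> phillips_central_moment W den n"
  assumes "structure_B W"
    and "n \<ge> 1"
    and "structure_H h I den n"
    and "h = poly q" and "degree q = r"
    and "\<forall>z\<in>B_X W. integrable lborel
           (\<lambda>t. t ^ max (m + 1) (m + r - 1) * phillips_density W den n z t)"
    and "x \<in> B_X W"
  shows "\<exists>\<alpha>' \<mu>'.
      (\<alpha> has_real_derivative \<alpha>') (at x within B_X W) \<and>
      (\<mu> m has_real_derivative \<mu>') (at x within B_X W) \<and>
      B_cov W x * (\<mu>' + real m * \<alpha>' * \<mu> (m - 1) x) =
        real n * \<mu> (m + 1) x + real n * (\<alpha> x - x) * \<mu> m x
        - (\<Sum>i=0..r. real (m + i) / fact i * (deriv ^^ i) h (\<alpha> x) * \<mu> (m + i - 1) x)"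
proof -
  \<comment> \<open>The highest moments in the recurrence have order m + 1 and, from i = r in the
    sum, m + r - 1.\<close>
  define N where "N = max (m + 1) (m + r - 1)"
  interpret phillips W den n N
    by unfold_locales
       (use assms in \<open>auto simp: structure_H_def N_def\<close>)
  have H: "structure_H (poly q) I den n" and x: "x \<in> B_X W" and q: "degree q = r"
    using assms by auto
  have N: "m + 1 \<le> N" "m + r \<le> N + 1" "1 \<le> N" "m \<le> N"
    by (auto simp: N_def)
  have \<alpha>_eq: "\<alpha> = (\<lambda>x. E x [:0, 1:])"
    by (simp add: fun_eq_iff \<alpha>_def phillips_mean_eq)
  have \<mu>_eq: "\<mu> i = (\<lambda>x. E x ([:- \<alpha> x, 1:] ^ i))" for i
    by (simp add: fun_eq_iff \<mu>_def \<alpha>_def phillips_central_moment_eq)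
  define a where "a = \<alpha> x"
  let ?u = "[:- a, 1:]"
  have deg: "degree (?u ^ i) = i" for i
    by (simp add: degree_linear_power)
  obtain \<alpha>' where \<alpha>': "(\<alpha> has_real_derivative \<alpha>') (at x within B_X W)"
    unfolding \<alpha>_eq by (rule has_derivative_expectation[of "[:0, 1:]" x]) (use N x in auto)
  obtain d where d: "((\<lambda>z. E z (?u ^ m)) has_real_derivative d) (at x within B_X W)"
    "B_cov W x * d = eval_fps (fps_X * fps_deriv (moment_series (?u ^ m))) (B_y W x) / eval_fps W (B_y W x) ^ n
      - real n * x * E x (?u ^ m)"
    by (rule has_derivative_expectation[of "?u ^ m" x]) (use N x deg in auto)
  define \<mu>' where "\<mu>' = d - real m * \<alpha>' * \<mu> (m - 1) x"
  have \<mu>': "(\<mu> m has_real_derivative \<mu>') (at x within B_X W)"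
    using has_derivative_central_moment[OF N(4) x \<alpha>' d(1)[unfolded a_def]]
    by (simp add: \<mu>'_def \<mu>_eq)
  \<comment> \<open>With u = t - a one has t u^m = a u^m + u^(m + 1), written as a sum over {0, 1}
    so that \<open>expectation_sum\<close> applies.\<close>
  have "pCons 0 (?u ^ m) = (\<Sum>j\<in>{0, 1}. smult (if j = 0 then a else 1) (?u ^ (m + j)))"
    by (simp add: mult_pCons_left)
  then have "E x (pCons 0 (?u ^ m)) = (\<Sum>j\<in>{0, 1}. (if j = 0 then a else 1) * E x (?u ^ (m + j)))"
    using N x by (simp only:) (intro expectation_sum, auto simp: deg)
  then have raise: "E x (pCons 0 (?u ^ m)) = a * \<mu> m x + \<mu> (m + 1) x"
    by (simp add: \<mu>_eq a_def)
  let ?h = "\<lambda>i. poly ((pderiv ^^ i) q) a"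
  have "pderiv (?u ^ m * q) = pderiv (?u ^ m * (\<Sum>i=0..r. smult (?h i / fact i) (?u ^ i)))"
    using poly_taylor[of q a] q by simp
  also have "\<dots> = (\<Sum>i=0..r. pderiv (smult (?h i / fact i) (?u ^ (m + i))))"
    by (simp add: sum_distrib_left power_add higher_pderiv_sum[where n = 1, simplified])
  \<comment> \<open>For m = i = 0 the exponent is truncated to 0, but the coefficient m + i is 0 as
    well.\<close>
  also have "\<dots> = (\<Sum>i=0..r. smult (?h i / fact i * real (m + i)) (?u ^ (m + i - 1)))"
    by (simp add: pderiv_smult pderiv_power pderiv_pCons)
  finally have "E x (pderiv (?u ^ m * q)) = (\<Sum>i=0..r. ?h i / fact i * real (m + i) * E x (?u ^ (m + i - 1)))"
    using N x by (simp only:) (intro expectation_sum, auto simp: deg)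
  also have "\<dots> = (\<Sum>i=0..r. real (m + i) / fact i * (deriv ^^ i) h (\<alpha> x) * \<mu> (m + i - 1) x)"
    by (intro sum.cong) (auto simp: \<open>h = poly q\<close> higher_deriv_poly \<mu>_eq a_def)
  finally have taylor: "E x (pderiv (?u ^ m * q)) = \<dots>" .
  \<comment> \<open>The term with \<open>\<alpha>'\<close> on the left cancels the one in
    \<open>\<mu>'\<close>, leaving the derivative of the expectation of the fixed polynomial (t -
    a)^m.\<close>
  have "B_cov W x * (\<mu>' + real m * \<alpha>' * \<mu> (m - 1) x) = B_cov W x * d"
    by (simp add: \<mu>'_def)
  also have "\<dots> = real n * E x (pCons 0 (?u ^ m)) - E x (pderiv (?u ^ m * q)) - real n * x * E x (?u ^ m)"
    unfolding d(2) by (subst eval_X_deriv_moment_series[OF H _ _ x]) (use N q deg in auto)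
  also have "\<dots> = real n * \<mu> (m + 1) x + real n * (\<alpha> x - x) * \<mu> m x
        - (\<Sum>i=0..r. real (m + i) / fact i * (deriv ^^ i) h (\<alpha> x) * \<mu> (m + i - 1) x)"
    unfolding raise taylor by (simp add: \<mu>_eq a_def algebra_simps)
  finally show ?thesis
    using \<alpha>' \<mu>' by blast
qed

end
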